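(* (a) Let $p=t-r$ with $r\in\mathbb{R}\setminus\{0\}$, let $n\in\mathbb{N}$, and let $V=\mathbb{R}[t]/(p^{n})\oplus b\,\mathbb{R}[t]/(p^{n})$. Then there is a real basis of $V$ in which $a$ and $b$ are represented by the block matrices $$a=\begin{pmatrix}A&0\\ 0&A^{-1}\end{pmatrix},\qquad b=\begin{pmatrix}0&-1_{n\times n}\\ 1_{n\times n}&0\end{pmatrix},$$ where $1_{n\times n}$ is the identity matrix and $A$ is the $n\times n$ matrix with $r$ in every diagonal entry, $1$ in every entry immediately above the diagonal, and $0$ elsewhere. (b) Let $p=(t-c)(t-\overline{c})$ where $c=e+if$ with $e,f\in\mathbb{R}$, $f\neq 0$, let $n\in\mathbb{N}$, and let $V=\mathbb{R}[t]/(p^{n})\oplus b\,\mathbb{R}[t]/(p^{n})$. Then there is a real basis of $V$ in which $a$ and $b$ are represented by the block matrices $$a=\begin{pmatrix}A&0\\ 0&A^{-1}\end{pmatrix},\qquad b=\begin{pmatrix}0&-1_{2n\times 2n}\\ 1_{2n\times 2n}&0\end{pmatrix},$$ where $A$ is the $2n\times 2n$ matrix consisting of $n\times n$ blocks of size $2\times 2$, with $D=\begin{pmatrix}e&-f\\ f&e\end{pmatrix}$ in every diagonal block, the identity $1_{2\times 2}$ in every block immediately above the diagonal, and $0$ in all other blocks.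
   Context: $iD_\infty$ is the associative unital algebra over $\mathbb{R}$ generated by two elements $a,b$ ($a$ and $b$ invertible) subject to the relations $bab^{-1}=a^{-1}$ and $b^2=-1$. $\mathbb{N}=\{1,2,\dots\}$. Notation: for $p\in\mathbb{R}[t]$ with $p(0)\neq 0$ (so that $t$ is invertible in $\mathbb{R}[t]/(p^n)$), $V=\mathbb{R}[t]/(p^{n})\oplus b\,\mathbb{R}[t]/(p^{n})$ denotes the $iD_\infty$-module whose underlying vector space is the direct sum of $\mathbb{R}[t]/(p^n)$ and a second copy of it, with elements written $b f$ for $f\in\mathbb{R}[t]/(p^n)$, and with action, for $f\in \mathbb{R}[t]/(p^n)$, $$a\cdot f=tf,\quad a\cdot (bf)=b(t^{-1}f),\quad b\cdot f=bf,\quad b\cdot(bf)=-f.$$ *)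

theory Defs
  imports
    "HOL-Computational_Algebra.Polynomial"
    "HOL-Algebra.QuotRing"
    "Jordan_Normal_Form.VS_Connect"
    "Jordan_Normal_Form.Jordan_Normal_Form"
begin

text \<open>
  The algebra \<open>iD\<^sub>\<infinity>\<close> over the reals is given by the invertible generators \<open>a\<close>, \<open>b\<close> and the
  relations \<open>b a b\<^sup>-\<^sup>1 = a\<^sup>-\<^sup>1\<close> and \<open>b\<^sup>2 = -1\<close>. A module over it is therefore a real vector
  space \<open>V\<close> together with two linear automorphisms satisfying these relations, namely the
  actions of \<open>a\<close> and \<open>b\<close>.
\<close>

locale iDinf_module =
  vectorspace "class_ring :: real ring" V
  for V :: "(real, 'v) module" (structure) and a b :: "'v \<Rightarrow> 'v" +
  assumes a_hom: "a \<in> LinearCombinations.module_hom class_ring V V"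
    and b_hom: "b \<in> LinearCombinations.module_hom class_ring V V"
    and a_bij: "bij_betw a (carrier V) (carrier V)"
    and b_bij: "bij_betw b (carrier V) (carrier V)"
    and conj_rel: "\<And>v. v \<in> carrier V \<Longrightarrow>
          b (a (inv_into (carrier V) b v)) = inv_into (carrier V) a v"
    and square_rel: "\<And>v. v \<in> carrier V \<Longrightarrow> b (b v) = \<ominus> v"

text \<open>The ring \<open>\<real>[t]/(p\<^sup>n)\<close>, whose elements are the cosets \<open>residue_class p n f\<close> of \<open>(p\<^sup>n)\<close>.\<close>

definition quot_ring :: "real poly \<Rightarrow> nat \<Rightarrow> real poly set ring" where
  "quot_ring p n = class_ring Quot (PIdl\<^bsub>class_ring\<^esub> (p ^ n))"

definition residue_class :: "real poly \<Rightarrow> nat \<Rightarrow> real poly \<Rightarrow> real poly set" where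
  "residue_class p n f = PIdl\<^bsub>class_ring\<^esub> (p ^ n) +>\<^bsub>class_ring\<^esub> f"

definition quot_space :: "real poly \<Rightarrow> nat \<Rightarrow> (real, real poly set) module" where
  "quot_space p n =
     ring.extend (quot_ring p n)
       (module.fields (\<lambda>c x. residue_class p n [:c:] \<otimes>\<^bsub>quot_ring p n\<^esub> x))"

text \<open>
  \<open>V = \<real>[t]/(p\<^sup>n) \<oplus> b \<real>[t]/(p\<^sup>n)\<close>: the pair \<open>(f, g)\<close> is the element \<open>f + b g\<close>. The inverse of
  \<open>t\<close> in \<^term>\<open>act_a\<close> is meaningful only if \<open>p(0) \<noteq> 0\<close>, see \<open>iDinf_module_V\<close> below.
\<close>

definition V_space :: "real poly \<Rightarrow> nat \<Rightarrow> (real, real poly set \<times> real poly set) module" where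
  "V_space p n = direct_sum (quot_space p n) (quot_space p n)"

definition act_a ::
  "real poly \<Rightarrow> nat \<Rightarrow> real poly set \<times> real poly set \<Rightarrow> real poly set \<times> real poly set" where
  "act_a p n = (\<lambda>(f, g).
     (residue_class p n [:0, 1:] \<otimes>\<^bsub>quot_ring p n\<^esub> f,
      inv\<^bsub>quot_ring p n\<^esub> (residue_class p n [:0, 1:]) \<otimes>\<^bsub>quot_ring p n\<^esub> g))"

definition act_b ::
  "real poly \<Rightarrow> nat \<Rightarrow> real poly set \<times> real poly set \<Rightarrow> real poly set \<times> real poly set" where
  "act_b p n = (\<lambda>(f, g). (\<ominus>\<^bsub>quot_ring p n\<^esub> g, f))"

definition ordered_basis :: "(real, 'v) module \<Rightarrow> 'v list \<Rightarrow> bool" where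
  "ordered_basis V vs \<longleftrightarrow> distinct vs \<and> vectorspace.basis class_ring V (set vs)"

text \<open>Column convention: the \<open>j\<close>-th column of the matrix holds the coordinates of \<open>T v\<^sub>j\<close>.\<close>

definition represented_by ::
  "(real, 'v) module \<Rightarrow> 'v list \<Rightarrow> ('v \<Rightarrow> 'v) \<Rightarrow> real mat \<Rightarrow> bool" where
  "represented_by V vs T M \<longleftrightarrow>
     M \<in> carrier_mat (length vs) (length vs) \<and>
     (\<forall>j < length vs. T (vs ! j) = (\<Oplus>\<^bsub>V\<^esub> i \<in> {..<length vs}. M $$ (i, j) \<odot>\<^bsub>V\<^esub> (vs ! i)))"

text \<open>
  The \<open>n \<times> n\<close> array of blocks of size \<open>k \<times> k\<close>, \<open>k\<close> being the dimension of \<open>D\<close>, with \<open>D\<close> on the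
  diagonal, identity blocks immediately above it, and zero blocks elsewhere.
\<close>

definition block_jordan :: "nat \<Rightarrow> real mat \<Rightarrow> real mat" where
  "block_jordan n D = (let k = dim_row D in
     mat (n * k) (n * k) (\<lambda>(i, j).
       if i div k = j div k then D $$ (i mod k, j mod k)
       else if Suc (i div k) = j div k then 1\<^sub>m k $$ (i mod k, j mod k)
       else 0))"

abbreviation poly_ideal :: "real poly \<Rightarrow> nat \<Rightarrow> real poly set" where
  "poly_ideal p n \<equiv> PIdl\<^bsub>class_ring\<^esub> (p ^ n)"

lemma poly_ideal: "ideal (poly_ideal p n) (class_ring :: real poly ring)"
  by (rule cring.cgenideal_ideal[OF class_cring.is_cring]) simp

lemma cring_quot_ring: "cring (quot_ring p n)"
  unfolding quot_ring_def
  by (rule ideal.quotient_is_cring[OF poly_ideal]) (rule class_cring.is_cring)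

lemma residue_class_hom: "residue_class p n \<in> Ring.ring_hom class_ring (quot_ring p n)"
  using ideal.rcos_ring_hom[OF poly_ideal, of p n]
  unfolding quot_ring_def residue_class_def[abs_def] by simp

lemma residue_class_closed: "residue_class p n f \<in> carrier (quot_ring p n)"
  using Ring.ring_hom_closed[OF residue_class_hom] by simp

lemma residue_class_mult:
  "residue_class p n (f * g) = residue_class p n f \<otimes>\<^bsub>quot_ring p n\<^esub> residue_class p n g"
  using Ring.ring_hom_mult[OF residue_class_hom, of f g] by simp

lemma residue_class_add:
  "residue_class p n (f + g) = residue_class p n f \<oplus>\<^bsub>quot_ring p n\<^esub> residue_class p n g"
  using Ring.ring_hom_add[OF residue_class_hom, of f g] by simp

lemma residue_class_one: "residue_class p n 1 = \<one>\<^bsub>quot_ring p n\<^esub>"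
  using Ring.ring_hom_one[OF residue_class_hom] by simp

lemma residue_class_zero: "residue_class p n (f * p ^ n) = \<zero>\<^bsub>quot_ring p n\<^esub>"
proof -
  have "f * p ^ n \<in> poly_ideal p n"
    unfolding cgenideal_def by auto
  then show ?thesis
    unfolding residue_class_def quot_ring_def FactRing_def
    using ideal.axioms(1)[OF poly_ideal, THEN additive_subgroup.a_subgroup]
    by (metis abelian_subgroup.a_rcos_const abelian_subgroupI3 class_ring.is_abelian_group
        ideal.axioms(1) poly_ideal ring_record_simps(11))
qed

lemma quot_space_vectorspace: "vectorspace class_ring (quot_space p n)"
proof -
  interpret Q: cring "quot_ring p n" by (rule cring_quot_ring)
  note s = quot_space_def ring.defs module.defs residue_class_closed
  have "Module.module class_ring (quot_space p n)"
  proof (rule Module.moduleI)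
    show "cring (class_ring :: real ring)" by (rule class_cring.is_cring)
    show "abelian_group (quot_space p n)"
    proof (rule abelian_groupI)
      fix x assume "x \<in> carrier (quot_space p n)"
      then show "\<exists>y\<in>carrier (quot_space p n). y \<oplus>\<^bsub>quot_space p n\<^esub> x = \<zero>\<^bsub>quot_space p n\<^esub>"
        by (simp add: s)
    qed (simp_all add: s Q.a_ac)
  next
    fix c d :: real and x y
    assume x: "x \<in> carrier (quot_space p n)" and y: "y \<in> carrier (quot_space p n)"
    then show "(c \<oplus>\<^bsub>class_ring\<^esub> d) \<odot>\<^bsub>quot_space p n\<^esub> x
      = c \<odot>\<^bsub>quot_space p n\<^esub> x \<oplus>\<^bsub>quot_space p n\<^esub> d \<odot>\<^bsub>quot_space p n\<^esub> x"
      using residue_class_add[of p n "[:c:]" "[:d:]"] by (simp add: s Q.l_distr)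
    show "(c \<otimes>\<^bsub>class_ring\<^esub> d) \<odot>\<^bsub>quot_space p n\<^esub> x
      = c \<odot>\<^bsub>quot_space p n\<^esub> (d \<odot>\<^bsub>quot_space p n\<^esub> x)"
      using x residue_class_mult[of p n "[:c:]" "[:d:]"] by (simp add: s Q.m_assoc mult.commute)
    show "c \<odot>\<^bsub>quot_space p n\<^esub> (x \<oplus>\<^bsub>quot_space p n\<^esub> y)
      = c \<odot>\<^bsub>quot_space p n\<^esub> x \<oplus>\<^bsub>quot_space p n\<^esub> c \<odot>\<^bsub>quot_space p n\<^esub> y"
      using x y by (simp add: s Q.r_distr)
    show "c \<odot>\<^bsub>quot_space p n\<^esub> x \<in> carrier (quot_space p n)"
      using x by (simp add: s)
    show "\<one>\<^bsub>class_ring\<^esub> \<odot>\<^bsub>quot_space p n\<^esub> x = x"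
      using x residue_class_one[of p n] by (simp add: s one_pCons)
  qed
  then show ?thesis
    unfolding vectorspace_def using class_field by blast
qed

lemma V_space_vectorspace: "vectorspace class_ring (V_space p n)"
  using quot_space_vectorspace[of p n] direct_sum_is_module[of class_ring "quot_space p n" "quot_space p n"]
  unfolding vectorspace_def V_space_def by blast

lemma t_unit:
  assumes "poly p 0 \<noteq> 0"
  shows "residue_class p n [:0, 1:] \<in> Units (quot_ring p n)"
proof -
  interpret Q: cring "quot_ring p n" by (rule cring_quot_ring)
  define c where "c = poly (p ^ n) 0"
  have c: "c \<noteq> 0" using assms by (simp add: c_def poly_power)
  obtain d s where ds: "p ^ n = pCons d s" by (cases "p ^ n")
  then have "d = c" by (simp add: c_def)
  then have "1 = [:0, 1:] * smult (- inverse c) s + [:inverse c:] * p ^ n"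
    using c by (simp add: ds one_pCons)
  then have "\<one>\<^bsub>quot_ring p n\<^esub>
    = residue_class p n [:0, 1:] \<otimes>\<^bsub>quot_ring p n\<^esub> residue_class p n (smult (- inverse c) s)"
    by (metis Q.r_zero Q.m_closed residue_class_add residue_class_closed residue_class_mult
        residue_class_one residue_class_zero)
  then show ?thesis
    unfolding Units_def using residue_class_closed Q.m_comm by (smt (verit) mem_Collect_eq)
qed

lemma iDinf_module_V:
  assumes "poly p 0 \<noteq> 0"
  shows "iDinf_module (V_space p n) (act_a p n) (act_b p n)"
proof -
  let ?Q = "quot_ring p n"
  let ?V = "V_space p n"
  let ?t = "residue_class p n [:0, 1:]"
  let ?u = "inv\<^bsub>?Q\<^esub> ?t"
  interpret Q: cring ?Q by (rule cring_quot_ring)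
  interpret V: vectorspace class_ring ?V by (rule V_space_vectorspace)
  note t = t_unit[OF assms, of n]
  have [simp]: "?t \<in> carrier ?Q" "?u \<in> carrier ?Q" "\<And>f. residue_class p n f \<in> carrier ?Q"
    using t by (auto simp: residue_class_closed)
  have tu [simp]: "?t \<otimes>\<^bsub>?Q\<^esub> (?u \<otimes>\<^bsub>?Q\<^esub> x) = x" "?u \<otimes>\<^bsub>?Q\<^esub> (?t \<otimes>\<^bsub>?Q\<^esub> x) = x"
    if "x \<in> carrier ?Q" for x
    using t that by (simp_all add: Q.m_assoc[symmetric])
  have V_carrier: "carrier ?V = carrier ?Q \<times> carrier ?Q"
    and V_add: "\<And>x y. x \<oplus>\<^bsub>?V\<^esub> y = (fst x \<oplus>\<^bsub>?Q\<^esub> fst y, snd x \<oplus>\<^bsub>?Q\<^esub> snd y)"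
    and V_zero: "\<zero>\<^bsub>?V\<^esub> = (\<zero>\<^bsub>?Q\<^esub>, \<zero>\<^bsub>?Q\<^esub>)"
    and V_smult: "\<And>c x. c \<odot>\<^bsub>?V\<^esub> x = (residue_class p n [:c:] \<otimes>\<^bsub>?Q\<^esub> fst x,
                                     residue_class p n [:c:] \<otimes>\<^bsub>?Q\<^esub> snd x)"
    by (simp_all add: V_space_def direct_sum_def quot_space_def ring.defs module.defs)
  note Vs = V_carrier V_add V_zero V_smult
  have a: "act_a p n \<in> LinearCombinations.module_hom class_ring ?V ?V"
    by (auto simp: LinearCombinations.module_hom_def Vs act_a_def Q.r_distr Q.m_lcomm)
  have b: "act_b p n \<in> LinearCombinations.module_hom class_ring ?V ?V"
    by (auto simp: LinearCombinations.module_hom_def Vs act_b_def Q.minus_add Q.r_minus)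
  let ?a' = "\<lambda>(f, g). (?u \<otimes>\<^bsub>?Q\<^esub> f, ?t \<otimes>\<^bsub>?Q\<^esub> g)"
  let ?b' = "\<lambda>(f, g). (g, \<ominus>\<^bsub>?Q\<^esub> f)"
  have a_bij: "bij_betw (act_a p n) (carrier ?V) (carrier ?V)"
    by (rule bij_betw_byWitness[where f' = ?a']) (auto simp: Vs act_a_def)
  have b_bij: "bij_betw (act_b p n) (carrier ?V) (carrier ?V)"
    by (rule bij_betw_byWitness[where f' = ?b']) (auto simp: Vs act_b_def)
  have a_inv: "inv_into (carrier ?V) (act_a p n) v = ?a' v" if "v \<in> carrier ?V" for v
    by (rule inv_into_f_eq) (use that a_bij in \<open>auto simp: Vs act_a_def bij_betw_def\<close>)
  have b_inv: "inv_into (carrier ?V) (act_b p n) v = ?b' v" if "v \<in> carrier ?V" for v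
    by (rule inv_into_f_eq) (use that b_bij in \<open>auto simp: Vs act_b_def bij_betw_def\<close>)
  have neg: "\<ominus>\<^bsub>?V\<^esub> v = (\<ominus>\<^bsub>?Q\<^esub> fst v, \<ominus>\<^bsub>?Q\<^esub> snd v)" if "v \<in> carrier ?V" for v
    by (rule V.minus_equality) (use that in \<open>auto simp: Vs Q.l_neg\<close>)
  show ?thesis
  proof (unfold_locales, goal_cases)
    case (5 v)
    then show ?case
      by (simp add: a_inv b_inv) (auto simp: Vs act_a_def act_b_def Q.r_minus)
  next
    case (6 v)
    then show ?case
      by (simp add: neg) (auto simp: Vs act_b_def)
  qed (fact a b a_bij b_bij)+
qed

end

theory Submission
  imports Defs "HOL-Number_Theory.Cong"
begin

text \<open>
  Both parts follow from one description of multiplication by \<open>t\<close> on \<open>\<real>[t]/(p\<^sup>n)\<close>. Let \<open>d\<close> be the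
  degree of \<open>p\<close>, and let \<open>B\<^sub>0 = 1, \<dots>, B\<^sub>d\<^sub>-\<^sub>1\<close> be independent modulo \<open>p\<close>. Suppose that modulo \<open>p\<^sup>n\<close> one can
  write \<open>t = s + N\<close>, where \<open>s\<close> acts on the span of the \<open>B\<^sub>l\<close> by a \<open>d \<times> d\<close> matrix \<open>D\<close>, and \<open>N\<close> generates
  the same ideal of \<open>\<real>[t]/(p\<^sup>n)\<close> as \<open>p\<close>. Then the products \<open>N\<^sup>k B\<^sub>l\<close> with \<open>k < n\<close> form a basis, and
  ordering them by decreasing \<open>k\<close> turns \<open>t N\<^sup>k B\<^sub>l = N\<^sup>k (s B\<^sub>l) + N\<^sup>k\<^sup>+\<^sup>1 B\<^sub>l\<close> into the block Jordan matrix
  of \<open>D\<close>.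

  For \<open>p = t - r\<close> one takes \<open>s = r\<close> and \<open>N = p\<close>. For \<open>p = (t - e)\<^sup>2 + f\<^sup>2\<close> the residue of \<open>(t - e)/f\<close> is a
  square root of \<open>-1\<close> modulo \<open>p\<close>, and Newton's iteration lifts it to a square root \<open>J\<close> of \<open>-1\<close> modulo
  \<open>p\<^sup>n\<close> (\<open>lift_sqrt_minus_one\<close>). So \<open>\<real>[t]/(p\<^sup>n)\<close> contains a copy \<open>\<real> + \<real>J\<close> of the complex numbers, in
  which \<open>s = e + f J\<close> plays the role of the root \<open>c\<close>; on the basis \<open>1, J\<close> it acts by
  the rotation block, and \<open>N = t - s\<close>.

  That the products \<open>N\<^sup>k B\<^sub>l\<close> are a basis can be seen directly. Their span is stable under \<open>t\<close> and
  contains \<open>1\<close>, so it is everything (\<open>residue_basisI\<close>). They are independent because the digits of an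
  \<open>N\<close>-adic expansion modulo \<open>p\<^sup>n\<close> can be read off one after the other (\<open>adic_expansion_unique\<close>).

  Finally, from any basis \<open>q\<close> of \<open>\<real>[t]/(p\<^sup>n)\<close> in which \<open>t\<close> has matrix \<open>A\<close>, the vectors \<open>q\<^sub>j\<close> followed by
  the vectors \<open>b q\<^sub>j\<close> are a basis of \<open>V\<close>. On the second half \<open>a\<close> acts by \<open>t\<^sup>-\<^sup>1\<close>, hence by \<open>A\<^sup>-\<^sup>1\<close>, and \<open>b\<close>
  exchanges the halves up to sign (\<open>matrices_on_doubled_basis\<close>).
\<close>

section \<open>Computing with representatives\<close>

lemma residue_class_eq_Collect: "residue_class p n f = {h. p ^ n dvd h - f}"
proof -
  have "residue_class p n f = {h. \<exists>g. h = g * p ^ n + f}"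
    by (auto simp: residue_class_def a_r_coset_def' cgenideal_def)
  also have "\<dots> = {h. p ^ n dvd h - f}"
    by (auto simp: dvd_def algebra_simps)
  finally show ?thesis .
qed

lemma residue_class_eq_iff: "residue_class p n f = residue_class p n g \<longleftrightarrow> p ^ n dvd f - g"
proof
  assume "residue_class p n f = residue_class p n g"
  moreover have "f \<in> residue_class p n f"
    by (simp add: residue_class_eq_Collect)
  ultimately have "f \<in> residue_class p n g"
    by (rule subst)
  then show "p ^ n dvd f - g"
    by (simp add: residue_class_eq_Collect)
next
  assume fg: "p ^ n dvd f - g"
  have "p ^ n dvd h - f \<longleftrightarrow> p ^ n dvd h - g" for h
    using dvd_add_left_iff[OF fg, of "h - f"] by simp
  then show "residue_class p n f = residue_class p n g"
    by (simp add: residue_class_eq_Collect)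
qed

lemma residue_class_eq_iff_cong:
  "residue_class p n f = residue_class p n g \<longleftrightarrow> [f = g] (mod p ^ n)"
  by (simp add: residue_class_eq_iff cong_iff_dvd_diff)

lemma carrier_quot_ring: "carrier (quot_ring p n) = range (residue_class p n)"
  by (auto simp: quot_ring_def FactRing_def A_RCOSETS_def' residue_class_def)

lemma residue_class_0: "residue_class p n 0 = \<zero>\<^bsub>quot_ring p n\<^esub>"
  using residue_class_zero[of p n 0] by simp

lemma residue_class_uminus: "residue_class p n (- f) = \<ominus>\<^bsub>quot_ring p n\<^esub> residue_class p n f"
proof -
  interpret Q: cring "quot_ring p n" by (rule cring_quot_ring)
  show ?thesis
    using residue_class_add[of p n "- f" f]
    by (intro Q.minus_equality[symmetric]) (simp_all add: residue_class_closed residue_class_0)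
qed

abbreviation residue_pair ::
  "real poly \<Rightarrow> nat \<Rightarrow> real poly \<Rightarrow> real poly \<Rightarrow> real poly set \<times> real poly set" where
  "residue_pair p n f g \<equiv> (residue_class p n f, residue_class p n g)"

lemma carrier_V_space: "carrier (V_space p n) = {residue_pair p n f g | f g. True}"
  by (auto simp: V_space_def direct_sum_def quot_space_def ring.defs module.defs carrier_quot_ring)

lemma residue_pair_add:
  "residue_pair p n f g \<oplus>\<^bsub>V_space p n\<^esub> residue_pair p n f' g' = residue_pair p n (f + f') (g + g')"
  by (simp add: V_space_def direct_sum_def quot_space_def ring.defs module.defs residue_class_add)

lemma residue_pair_smult:
  "c \<odot>\<^bsub>V_space p n\<^esub> residue_pair p n f g = residue_pair p n (smult c f) (smult c g)"
  by (simp add: V_space_def direct_sum_def quot_space_def ring.defs module.defs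
      residue_class_mult[symmetric])

lemma residue_pair_zero: "\<zero>\<^bsub>V_space p n\<^esub> = residue_pair p n 0 0"
  by (simp add: V_space_def direct_sum_def quot_space_def ring.defs module.defs residue_class_0)

lemma act_b_residue_pair: "act_b p n (residue_pair p n f g) = residue_pair p n (- g) f"
  by (simp add: act_b_def residue_class_uminus)

lemma act_a_residue_pair:
  assumes "p ^ n dvd [:0, 1:] * s - 1"
  shows "act_a p n (residue_pair p n f g) = residue_pair p n ([:0, 1:] * f) (s * g)"
proof -
  interpret Q: cring "quot_ring p n" by (rule cring_quot_ring)
  have "residue_class p n ([:0, 1:] * s) = residue_class p n 1"
    using assms by (simp only: residue_class_eq_iff)
  then have "residue_class p n [:0, 1:] \<otimes>\<^bsub>quot_ring p n\<^esub> residue_class p n s = \<one>\<^bsub>quot_ring p n\<^esub>"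
    by (simp only: residue_class_mult residue_class_one)
  then have "inv\<^bsub>quot_ring p n\<^esub> (residue_class p n [:0, 1:]) = residue_class p n s"
    by (intro Q.comm_inv_char residue_class_closed)
  then show ?thesis
    by (simp only: act_a_def residue_class_mult prod.case)
qed

lemma finsum_residue_pair:
  assumes "finite S"
  shows "(\<Oplus>\<^bsub>V_space p n\<^esub> i \<in> S. c i \<odot>\<^bsub>V_space p n\<^esub> residue_pair p n (g i) (h i))
    = residue_pair p n (\<Sum>i\<in>S. smult (c i) (g i)) (\<Sum>i\<in>S. smult (c i) (h i))"
proof -
  interpret V: vectorspace class_ring "V_space p n" by (rule V_space_vectorspace)
  show ?thesis
    using assms
  proof (induction S)
    case empty
    then show ?case by (simp add: residue_pair_zero)
  next
    case (insert i S)
    then show ?case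
      by (subst V.finsum_insert)
        (auto simp: residue_pair_smult residue_pair_add carrier_V_space)
  qed
qed

section \<open>Bases of the module from bases of the residue ring\<close>

lemma ordered_basisI:
  fixes V :: "(real, 'v) module"
  assumes "vectorspace class_ring V" and closed: "set vs \<subseteq> carrier V"
    and spanning: "\<And>v. v \<in> carrier V \<Longrightarrow>
      \<exists>\<alpha>. v = (\<Oplus>\<^bsub>V\<^esub> i \<in> {..<length vs}. \<alpha> i \<odot>\<^bsub>V\<^esub> (vs ! i))"
    and independent: "\<And>\<alpha> i. (\<Oplus>\<^bsub>V\<^esub> i \<in> {..<length vs}. \<alpha> i \<odot>\<^bsub>V\<^esub> (vs ! i)) = \<zero>\<^bsub>V\<^esub> \<Longrightarrow>
      i < length vs \<Longrightarrow> \<alpha> i = 0"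
    and "distinct vs"
  shows "ordered_basis V vs"
proof -
  interpret V: vectorspace class_ring V by fact
  let ?I = "{..<length vs}"
  have inj: "inj_on ((!) vs) ?I"
    using \<open>distinct vs\<close> by (simp add: inj_on_nth)
  have img: "(!) vs ` ?I = set vs"
    by (auto simp: set_conv_nth)
  have mem: "vs ! i \<in> carrier V" if "i < length vs" for i
    using closed that by (auto simp: subset_iff)
  have lincomb: "V.lincomb a (set vs) = (\<Oplus>\<^bsub>V\<^esub> i \<in> ?I. a (vs ! i) \<odot>\<^bsub>V\<^esub> (vs ! i))" for a
    unfolding V.lincomb_def img[symmetric]
    by (rule V.finsum_reindex) (use closed inj img in auto)
  have "v \<in> V.span (set vs)" if v: "v \<in> carrier V" for v
  proof -
    obtain \<alpha> where \<alpha>: "v = (\<Oplus>\<^bsub>V\<^esub> i \<in> ?I. \<alpha> i \<odot>\<^bsub>V\<^esub> (vs ! i))"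
      using spanning[OF v] by blast
    have "v = V.lincomb (\<lambda>w. \<alpha> (the_inv_into ?I ((!) vs) w)) (set vs)"
      unfolding \<alpha> lincomb
      by (rule V.finsum_cong') (simp_all add: mem Pi_def the_inv_into_f_f[OF inj])
    then show ?thesis
      unfolding V.span_def
      by (intro CollectI exI[of _ "set vs"] exI[of _ "\<lambda>w. \<alpha> (the_inv_into ?I ((!) vs) w)"]) simp
  qed
  moreover have "V.lin_indpt (set vs)"
  proof (rule V.finite_lin_indpt2)
    fix a assume "V.lincomb a (set vs) = \<zero>\<^bsub>V\<^esub>"
    then have "a (vs ! i) = 0" if "i < length vs" for i
      using independent[of "\<lambda>i. a (vs ! i)", OF _ that] unfolding lincomb by blast
    then show "\<forall>v\<in>set vs. a v = \<zero>\<^bsub>class_ring\<^esub>"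
      unfolding in_set_conv_nth Ball_def by fastforce
  qed (use closed in auto)
  ultimately show ?thesis
    unfolding ordered_basis_def V.basis_def
    using closed \<open>distinct vs\<close> V.span_is_subset2[OF closed] by blast
qed

text \<open>
  The residue classes of \<open>q 0, \<dots>, q (m - 1)\<close> form a basis of \<open>\<real>[t]/(p\<^sup>n)\<close>; indexing by position and
  speaking of representatives reduces all later arguments to divisibility of polynomials.
\<close>

definition residue_basis :: "real poly \<Rightarrow> nat \<Rightarrow> nat \<Rightarrow> (nat \<Rightarrow> real poly) \<Rightarrow> bool" where
  "residue_basis p n m q \<longleftrightarrow>
     (\<forall>f. \<exists>\<alpha>. p ^ n dvd f - (\<Sum>i<m. smult (\<alpha> i) (q i))) \<and>
     (\<forall>\<alpha>. p ^ n dvd (\<Sum>i<m. smult (\<alpha> i) (q i)) \<longrightarrow> (\<forall>i<m. \<alpha> i = 0))"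

lemma residue_basis_independent:
  assumes "residue_basis p n m q" "p ^ n dvd (\<Sum>i<m. smult (\<alpha> i) (q i))" "i < m"
  shows "\<alpha> i = 0"
  using assms unfolding residue_basis_def by blast

lemma residue_basis_spans:
  assumes "residue_basis p n m q"
  obtains \<alpha> where "p ^ n dvd f - (\<Sum>i<m. smult (\<alpha> i) (q i))"
  using assms unfolding residue_basis_def by blast

definition doubled_basis ::
  "real poly \<Rightarrow> nat \<Rightarrow> nat \<Rightarrow> (nat \<Rightarrow> real poly) \<Rightarrow> (real poly set \<times> real poly set) list" where
  "doubled_basis p n m q =
     map (\<lambda>i. residue_pair p n (if i < m then q i else 0) (if i < m then 0 else q (i - m))) [0..<m + m]"

lemma length_doubled_basis [simp]: "length (doubled_basis p n m q) = m + m"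
  by (simp add: doubled_basis_def)

lemma nth_doubled_basis:
  assumes "i < m + m"
  shows "doubled_basis p n m q ! i =
    residue_pair p n (if i < m then q i else 0) (if i < m then 0 else q (i - m))"
  using assms by (simp add: doubled_basis_def nth_map_upt)

lemma sum_lessThan_add:
  fixes f :: "nat \<Rightarrow> 'a::comm_monoid_add"
  shows "sum f {..<m + k} = sum f {..<m} + (\<Sum>i<k. f (m + i))"
  by (induction k) (simp_all add: add.assoc)

lemma lincomb_doubled_basis:
  "(\<Oplus>\<^bsub>V_space p n\<^esub> i \<in> {..<m + m}. \<alpha> i \<odot>\<^bsub>V_space p n\<^esub> (doubled_basis p n m q ! i))
    = residue_pair p n (\<Sum>i<m. smult (\<alpha> i) (q i)) (\<Sum>i<m. smult (\<alpha> (m + i)) (q i))"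
proof -
  interpret V: vectorspace class_ring "V_space p n" by (rule V_space_vectorspace)
  have "(\<Oplus>\<^bsub>V_space p n\<^esub> i \<in> {..<m + m}. \<alpha> i \<odot>\<^bsub>V_space p n\<^esub> (doubled_basis p n m q ! i))
    = (\<Oplus>\<^bsub>V_space p n\<^esub> i \<in> {..<m + m}. \<alpha> i \<odot>\<^bsub>V_space p n\<^esub>
        residue_pair p n (if i < m then q i else 0) (if i < m then 0 else q (i - m)))"
    by (rule V.finsum_cong') (auto simp: nth_doubled_basis residue_pair_smult carrier_V_space)
  then show ?thesis
    by (simp add: finsum_residue_pair sum_lessThan_add)
qed

lemma ordered_basis_doubled_basis:
  assumes "residue_basis p n m q"
  shows "ordered_basis (V_space p n) (doubled_basis p n m q)"
proof (rule ordered_basisI)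
  show "vectorspace class_ring (V_space p n)" by (rule V_space_vectorspace)
  show "set (doubled_basis p n m q) \<subseteq> carrier (V_space p n)"
    by (auto simp: doubled_basis_def carrier_V_space)
  show independent: "\<alpha> i = 0"
    if "(\<Oplus>\<^bsub>V_space p n\<^esub> i \<in> {..<length (doubled_basis p n m q)}.
          \<alpha> i \<odot>\<^bsub>V_space p n\<^esub> (doubled_basis p n m q ! i)) = \<zero>\<^bsub>V_space p n\<^esub>"
      and i: "i < length (doubled_basis p n m q)" for \<alpha> i
  proof -
    have "p ^ n dvd (\<Sum>i<m. smult (\<alpha> i) (q i))" "p ^ n dvd (\<Sum>i<m. smult (\<alpha> (m + i)) (q i))"
      using that(1) by (simp_all add: lincomb_doubled_basis residue_pair_zero residue_class_eq_iff)
    note zero = this[THEN residue_basis_independent[OF assms]]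
    show ?thesis
      using i zero(1)[of i] zero(2)[of "i - m"] by (cases "i < m") auto
  qed
  show "\<exists>\<alpha>. v = (\<Oplus>\<^bsub>V_space p n\<^esub> i \<in> {..<length (doubled_basis p n m q)}.
          \<alpha> i \<odot>\<^bsub>V_space p n\<^esub> (doubled_basis p n m q ! i))" if "v \<in> carrier (V_space p n)" for v
  proof -
    obtain f g where v: "v = residue_pair p n f g"
      using \<open>v \<in> _\<close> by (auto simp: carrier_V_space)
    obtain \<alpha> where "p ^ n dvd f - (\<Sum>i<m. smult (\<alpha> i) (q i))"
      using residue_basis_spans[OF assms] .
    moreover obtain \<beta> where "p ^ n dvd g - (\<Sum>i<m. smult (\<beta> i) (q i))"
      using residue_basis_spans[OF assms] .
    ultimately show ?thesis
      by (intro exI[of _ "\<lambda>i. if i < m then \<alpha> i else \<beta> (i - m)"])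
        (simp add: v lincomb_doubled_basis residue_class_eq_iff)
  qed
  (* If two entries agree, the difference of their unit coefficient vectors is a relation. *)
  show "distinct (doubled_basis p n m q)"
    unfolding distinct_conv_nth
  proof (intro allI impI notI)
    fix i j
    let ?vs = "doubled_basis p n m q"
    assume i: "i < length ?vs" and j: "j < length ?vs" and "i \<noteq> j" and eq: "?vs ! i = ?vs ! j"
    define \<alpha> where "\<alpha> k = (if k = i then 1 else 0) - (if k = j then 1 else 0 :: real)" for k
    have delta: "smult (if k = l then 1 else 0) f = (if k = l then f else 0)"
      for k l :: nat and f :: "real poly"
      by simp
    have shift: "m + k = l \<longleftrightarrow> m \<le> l \<and> k = l - m" for k l
      by auto
    have "p ^ n dvd (\<Sum>k<m. smult (\<alpha> k) (q k))" "p ^ n dvd (\<Sum>k<m. smult (\<alpha> (m + k)) (q k))"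
      using i j eq
      by (auto simp: nth_doubled_basis residue_class_eq_iff \<alpha>_def smult_diff_left sum_subtractf
          delta shift split: if_splits)
    then have "\<alpha> i = 0"
      by (intro independent)
        (use i in \<open>simp_all add: lincomb_doubled_basis residue_pair_zero residue_class_eq_iff\<close>)
    then show False
      using \<open>i \<noteq> j\<close> by (simp add: \<alpha>_def)
  qed
qed

lemma cong_smult: "[f = g] (mod P) \<Longrightarrow> [smult c f = smult c g] (mod P)" for P :: "real poly"
  using cong_scalar_left[of f g P "[:c:]"] by simp

text \<open>
  A subspace that contains \<open>1\<close> and is stable under \<open>t\<close> contains all polynomials, by Horner's rule;
  this replaces the comparison of dimensions.
\<close>

lemma residue_basisI:
  assumes stable: "\<And>j. j < m \<Longrightarrow>
      [[:0, 1:] * q j = (\<Sum>i<m. smult (A i j) (q i))] (mod p ^ n)"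
    and one: "k < m" "q k = 1"
    and independent: "\<And>\<alpha> i. p ^ n dvd (\<Sum>i<m. smult (\<alpha> i) (q i)) \<Longrightarrow> i < m \<Longrightarrow> \<alpha> i = 0"
  shows "residue_basis p n m q"
  unfolding residue_basis_def
proof (intro conjI allI impI)
  fix f
  have "\<exists>\<alpha>. [f = (\<Sum>i<m. smult (\<alpha> i) (q i))] (mod p ^ n)"
  proof (induction f)
    case 0
    show ?case by (intro exI[of _ "\<lambda>_. 0"]) simp
  next
    case (pCons a f)
    obtain \<alpha> where \<alpha>: "[f = (\<Sum>j<m. smult (\<alpha> j) (q j))] (mod p ^ n)"
      using pCons by blast
    have delta: "smult (if i = k then a else 0) (q i) = (if i = k then smult a 1 else 0)" for i
      using one by simp
    have "[[:0, 1:] * f = [:0, 1:] * (\<Sum>j<m. smult (\<alpha> j) (q j))] (mod p ^ n)"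
      by (intro cong_scalar_left \<alpha>)
    also have "[:0, 1:] * (\<Sum>j<m. smult (\<alpha> j) (q j)) = (\<Sum>j<m. smult (\<alpha> j) ([:0, 1:] * q j))"
      by (simp only: sum_distrib_left mult_smult_right)
    also have "[\<dots> = (\<Sum>j<m. smult (\<alpha> j) (\<Sum>i<m. smult (A i j) (q i)))] (mod p ^ n)"
      by (intro cong_sum cong_smult stable) simp
    also have "(\<Sum>j<m. smult (\<alpha> j) (\<Sum>i<m. smult (A i j) (q i)))
      = (\<Sum>i<m. smult (\<Sum>j<m. \<alpha> j * A i j) (q i))"
      by (simp only: smult_sum smult_sum2 smult_smult) (rule sum.swap)
    finally have "[smult a 1 + [:0, 1:] * f
      = smult a 1 + (\<Sum>i<m. smult (\<Sum>j<m. \<alpha> j * A i j) (q i))] (mod p ^ n)"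
      by (intro cong_add cong_refl)
    also have "smult a 1 + (\<Sum>i<m. smult (\<Sum>j<m. \<alpha> j * A i j) (q i))
      = (\<Sum>i<m. smult ((if i = k then a else 0) + (\<Sum>j<m. \<alpha> j * A i j)) (q i))"
      using one(1) by (simp add: smult_add_left sum.distrib delta)
    also have "smult a 1 + [:0, 1:] * f = pCons a f"
      by (simp add: one_pCons)
    finally show ?case
      by (rule exI[of _ "\<lambda>i. (if i = k then a else 0) + (\<Sum>j<m. \<alpha> j * A i j)"])
  qed
  then show "\<exists>\<alpha>. p ^ n dvd f - (\<Sum>i<m. smult (\<alpha> i) (q i))"
    by (simp add: cong_iff_dvd_diff)
qed (use independent in blast)

text \<open>
  The coordinates of the vectors \<open>t\<^sup>-\<^sup>1 q\<^sub>j\<close> form a right inverse of \<open>A\<close>, since \<open>t t\<^sup>-\<^sup>1 q\<^sub>j = q\<^sub>j\<close> and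
  coordinates are unique; for square matrices a right inverse is two-sided.
\<close>

lemma inverse_action:
  assumes basis: "residue_basis p n m q"
    and A: "A \<in> carrier_mat m m"
    and action: "\<And>j. j < m \<Longrightarrow>
      [[:0, 1:] * q j = (\<Sum>i<m. smult (A $$ (i, j)) (q i))] (mod p ^ n)"
    and s: "[[:0, 1:] * s = 1] (mod p ^ n)"
  obtains A' where "A' \<in> carrier_mat m m" "inverts_mat A A'" "inverts_mat A' A"
    "\<And>j. j < m \<Longrightarrow> [s * q j = (\<Sum>i<m. smult (A' $$ (i, j)) (q i))] (mod p ^ n)"
proof -
  have "\<exists>\<alpha>. [s * q j = (\<Sum>i<m. smult (\<alpha> i) (q i))] (mod p ^ n)" for j
    using residue_basis_spans[OF basis] by (metis cong_iff_dvd_diff)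
  then obtain \<alpha> where \<alpha>: "[s * q j = (\<Sum>i<m. smult (\<alpha> j i) (q i))] (mod p ^ n)" for j
    by metis
  define A' where "A' = mat m m (\<lambda>(i, j). \<alpha> j i)"
  have A': "A' \<in> carrier_mat m m"
    by (simp add: A'_def)
  have AA': "(A * A') $$ (i, j) = (if i = j then 1 else 0)" if "i < m" "j < m" for i j
  proof -
    let ?\<gamma> = "\<lambda>i. (A * A') $$ (i, j) - (if i = j then 1 else 0)"
    have "(\<Sum>i<m. smult ((A * A') $$ (i, j)) (q i))
      = (\<Sum>i<m. \<Sum>k<m. smult (\<alpha> j k) (smult (A $$ (i, k)) (q i)))"
      using A \<open>j < m\<close>
      by (intro sum.cong refl)
        (simp add: A'_def scalar_prod_def smult_sum lessThan_atLeast0 mult.commute)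
    also have "\<dots> = (\<Sum>k<m. smult (\<alpha> j k) (\<Sum>i<m. smult (A $$ (i, k)) (q i)))"
      by (subst sum.swap) (simp add: smult_sum2)
    also have "[\<dots> = (\<Sum>k<m. smult (\<alpha> j k) ([:0, 1:] * q k))] (mod p ^ n)"
      by (intro cong_sum cong_smult cong_sym[OF action]) simp
    also have "(\<Sum>k<m. smult (\<alpha> j k) ([:0, 1:] * q k)) = [:0, 1:] * (\<Sum>k<m. smult (\<alpha> j k) (q k))"
      by (simp only: sum_distrib_left mult_smult_right)
    also have "[\<dots> = [:0, 1:] * (s * q j)] (mod p ^ n)"
      by (intro cong_scalar_left cong_sym[OF \<alpha>])
    also have "[:0, 1:] * (s * q j) = [:0, 1:] * s * q j"
      by (simp only: mult.assoc)
    also have "[\<dots> = 1 * q j] (mod p ^ n)"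
      by (intro cong_scalar_right s)
    also have "1 * q j = (\<Sum>i<m. smult (if i = j then 1 else 0) (q i))"
    proof -
      have "smult (if i = j then 1 else 0) (q i) = (if i = j then q i else 0)" for i
        by simp
      then show ?thesis using \<open>j < m\<close> by simp
    qed
    finally have "p ^ n dvd (\<Sum>i<m. smult (?\<gamma> i) (q i))"
      by (simp only: smult_diff_left sum_subtractf cong_iff_dvd_diff)
    from residue_basis_independent[OF basis this \<open>i < m\<close>] show ?thesis by simp
  qed
  have "A * A' = 1\<^sub>m m"
    using A A' AA' by (intro eq_matI) auto
  moreover from this have "A' * A = 1\<^sub>m m"
    by (rule mat_mult_left_right_inverse[OF A A'])
  ultimately show ?thesis
    using A A' \<alpha> by (intro that[of A']) (auto simp: inverts_mat_def A'_def)
qed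

text \<open>
  The constant term of \<open>p\<^sup>n\<close> is nonzero, so solving \<open>p\<^sup>n = 0\<close> for it exhibits the inverse of \<open>t\<close>.
\<close>

lemma ex_inverse_of_t:
  assumes "poly p 0 \<noteq> (0 :: real)"
  obtains s where "[[:0, 1:] * s = 1] (mod p ^ n)"
proof -
  define c where "c = poly (p ^ n) 0"
  have c: "c \<noteq> 0" using assms by (simp add: c_def poly_power)
  obtain d s where ds: "p ^ n = pCons d s" by (cases "p ^ n")
  then have "d = c" by (simp add: c_def)
  then have "[:0, 1:] * smult (- inverse c) s - 1 = p ^ n * [:- inverse c:]"
    using c by (simp add: ds one_pCons)
  then show thesis
    by (intro that[of "smult (- inverse c) s"]) (simp only: cong_iff_dvd_diff dvd_triv_left)
qed

lemma matrices_on_doubled_basis: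
  assumes basis: "residue_basis p n m q" and "poly p 0 \<noteq> 0"
    and A: "A \<in> carrier_mat m m"
    and action: "\<And>j. j < m \<Longrightarrow>
      [[:0, 1:] * q j = (\<Sum>i<m. smult (A $$ (i, j)) (q i))] (mod p ^ n)"
  shows "\<exists>vs A'. ordered_basis (V_space p n) vs \<and>
         A' \<in> carrier_mat m m \<and> inverts_mat A A' \<and> inverts_mat A' A \<and>
         represented_by (V_space p n) vs (act_a p n)
           (four_block_mat A (0\<^sub>m m m) (0\<^sub>m m m) A') \<and>
         represented_by (V_space p n) vs (act_b p n)
           (four_block_mat (0\<^sub>m m m) (- 1\<^sub>m m) (1\<^sub>m m) (0\<^sub>m m m))"
proof -
  obtain s where s: "[[:0, 1:] * s = 1] (mod p ^ n)"
    using ex_inverse_of_t[OF \<open>poly p 0 \<noteq> 0\<close>] .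
  obtain A' where A': "A' \<in> carrier_mat m m" "inverts_mat A A'" "inverts_mat A' A"
    and inverse_action: "\<And>j. j < m \<Longrightarrow>
      [s * q j = (\<Sum>i<m. smult (A' $$ (i, j)) (q i))] (mod p ^ n)"
    using inverse_action[OF basis A action s] by blast
  have act_a: "act_a p n (residue_pair p n f g) = residue_pair p n ([:0, 1:] * f) (s * g)" for f g
    using s by (intro act_a_residue_pair) (simp only: cong_iff_dvd_diff)
  let ?vs = "doubled_basis p n m q"
  have "represented_by (V_space p n) ?vs (act_a p n) (four_block_mat A (0\<^sub>m m m) (0\<^sub>m m m) A')"
    unfolding represented_by_def length_doubled_basis lincomb_doubled_basis
  proof (intro conjI allI impI)
    fix j assume "j < m + m"
    then show "act_a p n (?vs ! j) = residue_pair p n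
      (\<Sum>i<m. smult (four_block_mat A (0\<^sub>m m m) (0\<^sub>m m m) A' $$ (i, j)) (q i))
      (\<Sum>i<m. smult (four_block_mat A (0\<^sub>m m m) (0\<^sub>m m m) A' $$ (m + i, j)) (q i))"
      using A A' action[of j] inverse_action[of "j - m"]
      by (simp add: nth_doubled_basis act_a residue_class_eq_iff_cong del: mult_pCons_left)
  qed (use A A' in auto)
  moreover have "represented_by (V_space p n) ?vs (act_b p n)
    (four_block_mat (0\<^sub>m m m) (- 1\<^sub>m m) (1\<^sub>m m) (0\<^sub>m m m))"
    unfolding represented_by_def length_doubled_basis lincomb_doubled_basis
  proof (intro conjI allI impI)
    fix j assume j: "j < m + m"
    have delta: "smult (if i = k then 1 else 0) (q i) = (if i = k then q i else 0)" for i k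
      by simp
    have lower: "j - m < m" if "\<not> j < m"
      using j that by simp
    show "act_b p n (?vs ! j) = residue_pair p n
      (\<Sum>i<m. smult (four_block_mat (0\<^sub>m m m) (- 1\<^sub>m m) (1\<^sub>m m) (0\<^sub>m m m) $$ (i, j)) (q i))
      (\<Sum>i<m. smult (four_block_mat (0\<^sub>m m m) (- 1\<^sub>m m) (1\<^sub>m m) (0\<^sub>m m m) $$ (m + i, j)) (q i))"
      using j lower by (cases "j < m") (simp_all add: nth_doubled_basis act_b_residue_pair delta sum_negf)
  qed auto
  ultimately show ?thesis
    using ordered_basis_doubled_basis[OF basis] A' by blast
qed

section \<open>Jordan chains in the residue ring\<close>

text \<open>
  The digits \<open>S k\<close> range over representatives among which only \<open>0\<close> is divisible by \<open>p\<close>.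
  Modulo \<open>p\<close> only the digit \<open>S 0\<close> survives, so it vanishes, and what remains is \<open>N\<close> times the shifted
  expansion. Since \<open>M N\<close> is \<open>p\<close> modulo \<open>p\<^sup>n\<close>, multiplying by \<open>M\<close> replaces this factor \<open>N\<close> by \<open>p\<close>, which can
  be cancelled against one factor of \<open>p\<^sup>m\<close>. Working with divisibility by \<open>p\<^sup>m\<close> for all \<open>m \<le> n\<close> makes
  this an induction.
\<close>

lemma adic_expansion_unique:
  fixes p N M :: "'a::idom"
  assumes "p \<noteq> 0" "p dvd N" "p ^ n dvd M * N - p"
    and "m \<le> n" "p ^ m dvd (\<Sum>k<m. N ^ k * S k)"
    and "\<And>k. k < m \<Longrightarrow> p dvd S k \<Longrightarrow> S k = 0" "k < m"
  shows "S k = 0"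
  using assms(4-7)
proof (induction m arbitrary: S k)
  case (Suc m)
  let ?T = "\<Sum>k<m. N ^ k * S (Suc k)"
  have split: "(\<Sum>k<Suc m. N ^ k * S k) = S 0 + N * ?T"
    by (subst sum.lessThan_Suc_shift) (simp add: sum_distrib_left mult.assoc)
  have "p dvd S 0 + N * ?T"
    using Suc.prems(2) unfolding split by (rule dvd_trans[rotated]) simp
  then have S0: "S 0 = 0"
    using \<open>p dvd N\<close> Suc.prems(3)[of 0] by (simp add: dvd_add_left_iff)
  have "p ^ Suc m dvd M * (N * ?T) - (M * N - p) * ?T"
  proof (rule dvd_diff)
    show "p ^ Suc m dvd M * (N * ?T)"
      using Suc.prems(2) unfolding split S0 by simp
    show "p ^ Suc m dvd (M * N - p) * ?T"
      using assms(3) le_imp_power_dvd[OF Suc.prems(1), of p] by (metis dvd_mult2 dvd_trans)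
  qed
  also have "M * (N * ?T) - (M * N - p) * ?T = p * ?T"
    by (simp add: algebra_simps)
  finally have "p ^ m dvd ?T"
    using \<open>p \<noteq> 0\<close> by simp
  then have "S (Suc k) = 0" if "k < m" for k
    using Suc.IH[of "\<lambda>k. S (Suc k)" k] Suc.prems(1,3) that by simp
  then show ?case
    using S0 Suc.prems(4) by (cases k) auto
qed simp

lemma sum_lessThan_mult:
  fixes f :: "nat \<Rightarrow> 'a::comm_monoid_add"
  shows "sum f {..<n * d} = (\<Sum>b<n. \<Sum>l<d. f (b * d + l))"
  by (induction n) (simp_all add: sum_lessThan_add add.commute[of d])

text \<open>
  The exponent decreases from block to block and reaches \<open>0\<close> in the last one, because the identity
  blocks of \<^const>\<open>block_jordan\<close> lie above the diagonal: \<open>N\<close> must send each block to the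
  previous one, and the first block to multiples of \<open>N\<^sup>n\<close>.
\<close>

definition jordan_chains :: "nat \<Rightarrow> nat \<Rightarrow> real poly \<Rightarrow> (nat \<Rightarrow> real poly) \<Rightarrow> nat \<Rightarrow> real poly" where
  "jordan_chains n d N B j = N ^ (n - Suc (j div d)) * B (j mod d)"

lemma sum_jordan_chains:
  "(\<Sum>j<n * d. smult (\<alpha> j) (jordan_chains n d N B j))
    = (\<Sum>b<n. N ^ (n - Suc b) * (\<Sum>l<d. smult (\<alpha> (b * d + l)) (B l)))"
  unfolding sum_lessThan_mult
  by (intro sum.cong refl) (simp add: jordan_chains_def sum_distrib_left)

text \<open>
  In column \<open>j\<close> of the block Jordan matrix only two blocks are nonzero: the diagonal one, which gives
  the action of \<open>D\<close>, and the identity block above it, which gives multiplication by \<open>N\<close>. For the first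
  block the latter is missing, in accordance with \<open>N\<^sup>n = 0\<close> modulo \<open>p\<^sup>n\<close>.
\<close>

lemma jordan_chains_action:
  assumes D: "D \<in> carrier_mat d d"
    and block: "\<And>l. l < d \<Longrightarrow>
      [[:0, 1:] * B l = (\<Sum>l'<d. smult (D $$ (l', l)) (B l')) + N * B l] (mod p ^ n)"
    and "p dvd N" and j: "j < n * d"
  shows "[[:0, 1:] * jordan_chains n d N B j =
    (\<Sum>i<n * d. smult (block_jordan n D $$ (i, j)) (jordan_chains n d N B i))] (mod p ^ n)"
proof -
  define b l where "b = j div d" and "l = j mod d"
  have "d > 0" using j by (cases d) auto
  then have b: "b < n" and l: "l < d"
    using j by (simp_all add: b_def l_def less_mult_imp_div_less)
  let ?E = "\<Sum>l'<d. smult (D $$ (l', l)) (B l')"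
  let ?above = "if b = 0 then 0 else N ^ (n - b) * B l"
  have entry: "block_jordan n D $$ (b' * d + l', j) =
      (if b' = b then D $$ (l', l) else if Suc b' = b then if l' = l then 1 else 0 else 0)"
    if "b' < n" "l' < d" for b' l'
  proof -
    have "b' * d + l' < n * d"
      using that mult_le_mono1[of "Suc b'" n d] by simp
    then show ?thesis
      using D j that l by (simp add: block_jordan_def b_def l_def)
  qed
  have inner: "(\<Sum>l'<d. smult (block_jordan n D $$ (b' * d + l', j)) (B l')) =
      (if b' = b then ?E else if Suc b' = b then B l else 0)" if "b' < n" for b'
  proof -
    have delta: "smult (if l' = l then 1 else 0) (B l') = (if l' = l then B l' else 0)" for l'
      by simp
    show ?thesis
      using that l by (simp add: entry delta)
  qed
  have "(\<Sum>i<n * d. smult (block_jordan n D $$ (i, j)) (jordan_chains n d N B i))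
    = (\<Sum>b'<n. N ^ (n - Suc b') * (if b' = b then ?E else if Suc b' = b then B l else 0))"
    unfolding sum_jordan_chains by (intro sum.cong refl) (simp add: inner)
  also have "\<dots> = (\<Sum>b'<n. (if b' = b then N ^ (n - Suc b) * ?E else 0)
      + (if Suc b' = b then N ^ (n - b) * B l else 0))"
    by (intro sum.cong refl) auto
  also have "\<dots> = N ^ (n - Suc b) * ?E + ?above"
    using b by (cases b) (simp_all add: sum.distrib)
  finally have rhs: "(\<Sum>i<n * d. smult (block_jordan n D $$ (i, j)) (jordan_chains n d N B i))
    = N ^ (n - Suc b) * ?E + ?above" .
  have "[:0, 1:] * jordan_chains n d N B j = N ^ (n - Suc b) * ([:0, 1:] * B l)"
    by (simp only: jordan_chains_def b_def l_def mult_ac)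
  also have "[\<dots> = N ^ (n - Suc b) * (?E + N * B l)] (mod p ^ n)"
    by (intro cong_scalar_left block l)
  also have "N ^ (n - Suc b) * (?E + N * B l) = N ^ (n - Suc b) * ?E + N ^ (n - b) * B l"
  proof -
    have "N ^ (n - b) = N ^ (n - Suc b) * N"
      using b by (metis Suc_diff_Suc power_Suc2)
    then show ?thesis by (simp add: algebra_simps)
  qed
  also have "[\<dots> = N ^ (n - Suc b) * ?E + ?above] (mod p ^ n)"
    using dvd_power_same[OF \<open>p dvd N\<close>, of n]
    by (intro cong_add cong_refl) (auto simp: cong_0_iff)
  finally show ?thesis
    unfolding rhs .
qed

lemma residue_basis_jordan_chains:
  assumes "p \<noteq> 0" "p dvd N" "p ^ n dvd M * N - p"
    and D: "D \<in> carrier_mat d d"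
    and block: "\<And>l. l < d \<Longrightarrow>
      [[:0, 1:] * B l = (\<Sum>l'<d. smult (D $$ (l', l)) (B l')) + N * B l] (mod p ^ n)"
    and independent: "\<And>\<beta> l. p dvd (\<Sum>l<d. smult (\<beta> l) (B l)) \<Longrightarrow> l < d \<Longrightarrow> \<beta> l = 0"
    and "n > 0" "d > 0" "B 0 = 1"
  shows "residue_basis p n (n * d) (jordan_chains n d N B)"
proof (rule residue_basisI[where A = "\<lambda>i j. block_jordan n D $$ (i, j)" and k = "(n - 1) * d"])
  show "[[:0, 1:] * jordan_chains n d N B j =
    (\<Sum>i<n * d. smult (block_jordan n D $$ (i, j)) (jordan_chains n d N B i))] (mod p ^ n)"
    if "j < n * d" for j
    using D block \<open>p dvd N\<close> that by (rule jordan_chains_action)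
  show "(n - 1) * d < n * d" "jordan_chains n d N B ((n - 1) * d) = 1"
    using \<open>n > 0\<close> \<open>d > 0\<close> \<open>B 0 = 1\<close> by (simp_all add: jordan_chains_def)
  fix \<alpha> i
  assume dvd: "p ^ n dvd (\<Sum>j<n * d. smult (\<alpha> j) (jordan_chains n d N B j))" and i: "i < n * d"
  let ?S = "\<lambda>b. \<Sum>l<d. smult (\<alpha> (b * d + l)) (B l)"
  have S: "?S b = 0" if "p dvd ?S b" for b
    using independent[OF that] by simp
  have reflect: "n - Suc (n - Suc k) = k" if "k < n" for k
    using that by simp
  have "p ^ n dvd (\<Sum>b<n. N ^ (n - Suc b) * ?S b)"
    using dvd unfolding sum_jordan_chains .
  also have "(\<Sum>b<n. N ^ (n - Suc b) * ?S b)
    = (\<Sum>k<n. N ^ (n - Suc (n - Suc k)) * ?S (n - Suc k))"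
    by (rule sum.nat_diff_reindex[symmetric])
  also have "\<dots> = (\<Sum>k<n. N ^ k * ?S (n - Suc k))"
    by (rule sum.cong) (simp_all only: lessThan_iff reflect)
  finally have expansion: "p ^ n dvd (\<Sum>k<n. N ^ k * ?S (n - Suc k))" .
  have "i div d < n" "i mod d < d"
    using i \<open>d > 0\<close> by (simp_all add: less_mult_imp_div_less)
  have "?S (n - Suc (n - Suc (i div d))) = 0"
    by (rule adic_expansion_unique[where S = "\<lambda>k. ?S (n - Suc k)",
          OF assms(1-3) order_refl expansion S]) (use \<open>i div d < n\<close> in simp_all)
  then have "?S (i div d) = 0"
    by (simp only: reflect \<open>i div d < n\<close>)
  then show "\<alpha> i = 0"
    using independent[of "\<lambda>l. \<alpha> (i div d * d + l)" "i mod d"] \<open>i mod d < d\<close> by simp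
qed

lemma block_jordan_matrices:
  assumes "p \<noteq> 0" "p dvd N" "p ^ n dvd M * N - p"
    and D: "D \<in> carrier_mat d d"
    and block: "\<And>l. l < d \<Longrightarrow>
      [[:0, 1:] * B l = (\<Sum>l'<d. smult (D $$ (l', l)) (B l')) + N * B l] (mod p ^ n)"
    and independent: "\<And>\<beta> l. p dvd (\<Sum>l<d. smult (\<beta> l) (B l)) \<Longrightarrow> l < d \<Longrightarrow> \<beta> l = 0"
    and "n > 0" "d > 0" "B 0 = 1" and "poly p 0 \<noteq> 0"
    and m: "m = n * d" and A: "A = block_jordan n D"
  shows "\<exists>vs A'. ordered_basis (V_space p n) vs \<and>
         A' \<in> carrier_mat m m \<and> inverts_mat A A' \<and> inverts_mat A' A \<and>
         represented_by (V_space p n) vs (act_a p n)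
           (four_block_mat A (0\<^sub>m m m) (0\<^sub>m m m) A') \<and>
         represented_by (V_space p n) vs (act_b p n)
           (four_block_mat (0\<^sub>m m m) (- 1\<^sub>m m) (1\<^sub>m m) (0\<^sub>m m m))"
proof (rule matrices_on_doubled_basis)
  show "residue_basis p n m (jordan_chains n d N B)"
    unfolding m by (rule residue_basis_jordan_chains) fact+
  show "A \<in> carrier_mat m m"
    using D by (auto simp: A m block_jordan_def Let_def)
  show "[[:0, 1:] * jordan_chains n d N B j =
    (\<Sum>i<m. smult (A $$ (i, j)) (jordan_chains n d N B i))] (mod p ^ n)" if "j < m" for j
    using that unfolding A m by (intro jordan_chains_action D block \<open>p dvd N\<close>)
qed fact

section \<open>Linear and irreducible quadratic polynomials\<close>

lemma block_jordan_1: "block_jordan n (mat 1 1 (\<lambda>_. r)) = jordan_block n r"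
  by (intro eq_matI) (auto simp: block_jordan_def)

text \<open>
  One Newton step for \<open>J\<^sup>2 + 1\<close> with error \<open>E = J\<^sup>2 + 1\<close> is \<open>J + E / (-2J)\<close>. As \<open>-1/J\<close> is approximately
  \<open>J\<close>, the step \<open>J + E J / 2\<close> works as well, and it divides only by \<open>2\<close>: the new error is exactly
  \<open>E\<^sup>2 (1 + J\<^sup>2 / 4)\<close>. Here \<open>h\<close> is one half.
\<close>

lemma lift_sqrt_minus_one:
  fixes p h J\<^sub>0 :: "'a::comm_ring_1"
  assumes h: "h + h = 1" and "p dvd J\<^sub>0 ^ 2 + 1"
  obtains J where "p ^ n dvd J ^ 2 + 1" "p dvd J - J\<^sub>0"
proof -
  have "\<exists>J. p ^ Suc n dvd J ^ 2 + 1 \<and> p dvd J - J\<^sub>0" for n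
  proof (induction n)
    case 0
    then show ?case using assms(2) by (intro exI[of _ J\<^sub>0]) simp
  next
    case (Suc n)
    then obtain J where J: "p ^ Suc n dvd J ^ 2 + 1" "p dvd J - J\<^sub>0" by blast
    define E where "E = J ^ 2 + 1"
    have E: "p ^ Suc n dvd E" "p dvd E"
      using J(1) dvd_trans[OF _ J(1), of p] by (simp_all add: E_def)
    define J' where "J' = J + h * E * J"
    have "J' ^ 2 + 1 = E + (h + h) * E * J ^ 2 + h ^ 2 * E ^ 2 * J ^ 2"
      by (simp add: J'_def E_def algebra_simps power2_eq_square)
    also have "\<dots> = E * E * (1 + h ^ 2 * J ^ 2)"
      by (simp add: h E_def algebra_simps power2_eq_square)
    finally have "p ^ Suc n * p dvd J' ^ 2 + 1"
      using mult_dvd_mono[OF E] by (metis dvd_mult2)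
    moreover have "p dvd (J - J\<^sub>0) + E * (h * J)"
      using J(2) E(2) by (intro dvd_add dvd_mult2)
    then have "p dvd J' - J\<^sub>0"
      by (simp add: J'_def algebra_simps)
    ultimately show ?case by (metis power_Suc2)
  qed
  from this[of n] show thesis
    using that by (meson le_SucI order_refl power_le_dvd)
qed

lemma linear_matrices:
  fixes r :: real
  assumes "r \<noteq> 0" "n \<ge> 1" and p: "p = [:- r, 1:]"
  shows "\<exists>vs A'. ordered_basis (V_space p n) vs \<and>
         A' \<in> carrier_mat n n \<and> inverts_mat (jordan_block n r) A' \<and> inverts_mat A' (jordan_block n r) \<and>
         represented_by (V_space p n) vs (act_a p n)
           (four_block_mat (jordan_block n r) (0\<^sub>m n n) (0\<^sub>m n n) A') \<and>
         represented_by (V_space p n) vs (act_b p n)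
           (four_block_mat (0\<^sub>m n n) (- 1\<^sub>m n) (1\<^sub>m n) (0\<^sub>m n n))"
proof (rule block_jordan_matrices[where N = p and M = 1 and d = 1 and B = "\<lambda>_. 1"
      and D = "mat 1 1 (\<lambda>_. r)"])
  fix \<beta> :: "nat \<Rightarrow> real" and l :: nat
  assume "p dvd (\<Sum>l<1. smult (\<beta> l) 1)" and l: "l < 1"
  then have "p dvd [:\<beta> 0:]" by (simp add: one_pCons)
  then have "\<beta> 0 = 0"
    using dvd_imp_degree_le[of p "[:\<beta> 0:]"] by (auto simp: p)
  then show "\<beta> l = 0" using l by simp
qed (use assms in \<open>auto simp: block_jordan_1[simplified] one_pCons\<close>)

text \<open>
  With \<open>N = t - e - f J\<close> one has \<open>p = (N + f J)\<^sup>2 + f\<^sup>2\<close>, and since \<open>J\<^sup>2 = -1\<close> modulo \<open>p\<^sup>n\<close> this is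
  \<open>N (N + 2 f J)\<close> there. The second factor is the conjugate \<open>t - e + f J\<close>, so this is the
  factorization of \<open>p\<close> over the copy \<open>\<real> + \<real>J\<close> of the complex numbers.
\<close>

lemma quadratic_matrices:
  fixes e f :: real
  assumes "f \<noteq> 0" "n \<ge> 1" and p: "p = [:e\<^sup>2 + f\<^sup>2, - 2 * e, 1:]"
    and A: "A = block_jordan n (mat_of_rows_list 2 [[e, - f], [f, e]])"
  shows "\<exists>vs A'. ordered_basis (V_space p n) vs \<and>
         A' \<in> carrier_mat (2 * n) (2 * n) \<and> inverts_mat A A' \<and> inverts_mat A' A \<and>
         represented_by (V_space p n) vs (act_a p n)
           (four_block_mat A (0\<^sub>m (2 * n) (2 * n)) (0\<^sub>m (2 * n) (2 * n)) A') \<and>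
         represented_by (V_space p n) vs (act_b p n)
           (four_block_mat (0\<^sub>m (2 * n) (2 * n)) (- 1\<^sub>m (2 * n))
                           (1\<^sub>m (2 * n)) (0\<^sub>m (2 * n) (2 * n)))"
proof -
  define J\<^sub>0 where "J\<^sub>0 = [:- e / f, 1 / f:]"
  have "J\<^sub>0 ^ 2 + 1 = p * [:1 / f ^ 2:]"
    using \<open>f \<noteq> 0\<close> by (simp add: J\<^sub>0_def p power2_eq_square one_pCons field_simps)
  then have J\<^sub>0: "p dvd J\<^sub>0 ^ 2 + 1"
    by (simp only: dvd_triv_left)
  obtain J where J: "p ^ n dvd J ^ 2 + 1" "p dvd J - J\<^sub>0"
    using lift_sqrt_minus_one[of "[:1 / 2:] :: real poly", OF _ J\<^sub>0] by (auto simp: one_pCons)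
  define N where "N = [:- e, 1:] - [:f:] * J"
  have t: "[:0, 1:] = N + [:e:] + [:f:] * J"
    by (simp add: N_def)
  have "N = (J - J\<^sub>0) * [:- f:]"
    using \<open>f \<noteq> 0\<close> by (simp add: N_def J\<^sub>0_def algebra_simps)
  then have "p dvd N"
    using J(2) by (simp only: dvd_mult2)
  have norm_form: "(N + 2 * F * J) * N - ((N + F * J) ^ 2 + F ^ 2) = (J ^ 2 + 1) * (- (F ^ 2))"
    for F :: "real poly"
    by (simp add: power2_eq_square algebra_simps)
  have "p = (N + [:f:] * J) ^ 2 + [:f:] ^ 2"
    by (simp add: N_def p power2_eq_square algebra_simps)
  then have "(N + 2 * [:f:] * J) * N - p = (J ^ 2 + 1) * (- ([:f:] ^ 2))"
    by (simp only: norm_form)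
  then have M: "p ^ n dvd (N + 2 * [:f:] * J) * N - p"
    using J(1) by simp
  define B where "B l = (if l = 0 then 1 else J)" for l :: nat
  let ?D = "mat_of_rows_list 2 [[e, - f], [f, e]]"
  have two: "{..<2} = {0, 1 :: nat}" by auto
  show ?thesis
  proof (rule block_jordan_matrices[where d = 2 and B = B and D = ?D, OF _ \<open>p dvd N\<close> M])
    fix l :: nat assume "l < 2"
    then consider "l = 0" | "l = 1" by linarith
    then show "[[:0, 1:] * B l = (\<Sum>l'<2. smult (?D $$ (l', l)) (B l')) + N * B l] (mod p ^ n)"
    proof cases
      case 1
      then show ?thesis
        by (simp add: two mat_of_rows_list_def B_def N_def one_pCons)
    next
      case 2
      have "[:0, 1:] * J - ([:- f:] + [:e:] * J + N * J) = (J ^ 2 + 1) * [:f:]"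
        by (simp only: t) (simp add: algebra_simps power2_eq_square)
      then have "p ^ n dvd [:0, 1:] * J - ([:- f:] + [:e:] * J + N * J)"
        using J(1) by (simp only: dvd_mult2)
      then show ?thesis
        using 2 by (simp add: two mat_of_rows_list_def B_def one_pCons cong_iff_dvd_diff)
    qed
  next
    fix \<beta> :: "nat \<Rightarrow> real" and l :: nat
    assume "p dvd (\<Sum>l<2. smult (\<beta> l) (B l))" and l: "l < 2"
    (* Modulo p, J may be replaced by its approximation of degree 1, below the degree of p. *)
    then have "p dvd [:\<beta> 0:] + [:\<beta> 1:] * J - [:\<beta> 1:] * (J - J\<^sub>0)"
      by (intro dvd_diff[OF _ dvd_mult[OF J(2)]]) (simp add: two B_def one_pCons)
    also have "[:\<beta> 0:] + [:\<beta> 1:] * J - [:\<beta> 1:] * (J - J\<^sub>0) = [:\<beta> 0 - \<beta> 1 * e / f, \<beta> 1 / f:]"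
      by (simp add: J\<^sub>0_def algebra_simps)
    finally have "p dvd [:\<beta> 0 - \<beta> 1 * e / f, \<beta> 1 / f:]" .
    moreover have "degree [:\<beta> 0 - \<beta> 1 * e / f, \<beta> 1 / f:] < degree p"
      by (simp add: p)
    ultimately have "[:\<beta> 0 - \<beta> 1 * e / f, \<beta> 1 / f:] = 0"
      using dvd_imp_degree_le not_less by blast
    then have "\<beta> 1 = 0" "\<beta> 0 = 0"
      using \<open>f \<noteq> 0\<close> by auto
    then show "\<beta> l = 0"
      using l by (metis less_2_cases One_nat_def)
  next
    show "?D \<in> carrier_mat 2 2"
      by (auto simp: mat_of_rows_list_def)
  qed (use assms in \<open>simp_all add: B_def add_pos_pos order_less_imp_not_eq2\<close>)
qed

lemma real_quadratic_of_conjugate_roots: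
  assumes "map_poly complex_of_real p = [:- c, 1:] * [:- cnj c, 1:]"
  shows "p = [:(Re c)\<^sup>2 + (Im c)\<^sup>2, - 2 * Re c, 1:]"
proof -
  have "map_poly complex_of_real p = map_poly complex_of_real [:(Re c)\<^sup>2 + (Im c)\<^sup>2, - 2 * Re c, 1:]"
    unfolding assms by (simp add: map_poly_pCons complex_eq_iff power2_eq_square)
  then show ?thesis
    by (auto simp: poly_eq_iff coeff_map_poly)
qed


theorem corollary1p1:
  shows
  "(\<forall>(r :: real) (n :: nat) (p :: real poly) (A :: real mat).
      r \<noteq> 0 \<and> n \<ge> 1 \<and> p = [:- r, 1:] \<and> A = jordan_block n r \<longrightarrow>
      (\<exists>vs A'. ordered_basis (V_space p n) vs \<and>
         A' \<in> carrier_mat n n \<and> inverts_mat A A' \<and> inverts_mat A' A \<and>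
         represented_by (V_space p n) vs (act_a p n)
           (four_block_mat A (0\<^sub>m n n) (0\<^sub>m n n) A') \<and>
         represented_by (V_space p n) vs (act_b p n)
           (four_block_mat (0\<^sub>m n n) (- 1\<^sub>m n) (1\<^sub>m n) (0\<^sub>m n n))))
   \<and>
   (\<forall>(e :: real) (f :: real) (c :: complex) (n :: nat) (p :: real poly) (A :: real mat).
      f \<noteq> 0 \<and> c = Complex e f \<and> n \<ge> 1 \<and>
      map_poly complex_of_real p = [:- c, 1:] * [:- cnj c, 1:] \<and>
      A = block_jordan n (mat_of_rows_list 2 [[e, - f], [f, e]]) \<longrightarrow>
      (\<exists>vs A'. ordered_basis (V_space p n) vs \<and>
         A' \<in> carrier_mat (2 * n) (2 * n) \<and> inverts_mat A A' \<and> inverts_mat A' A \<and>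
         represented_by (V_space p n) vs (act_a p n)
           (four_block_mat A (0\<^sub>m (2 * n) (2 * n)) (0\<^sub>m (2 * n) (2 * n)) A') \<and>
         represented_by (V_space p n) vs (act_b p n)
           (four_block_mat (0\<^sub>m (2 * n) (2 * n)) (- 1\<^sub>m (2 * n))
                           (1\<^sub>m (2 * n)) (0\<^sub>m (2 * n) (2 * n)))))"
proof (intro conjI allI impI)
  fix r :: real and n p A
  assume "r \<noteq> 0 \<and> n \<ge> 1 \<and> p = [:- r, 1:] \<and> A = jordan_block n r"
  then show "\<exists>vs A'. ordered_basis (V_space p n) vs \<and>
         A' \<in> carrier_mat n n \<and> inverts_mat A A' \<and> inverts_mat A' A \<and>
         represented_by (V_space p n) vs (act_a p n)
           (four_block_mat A (0\<^sub>m n n) (0\<^sub>m n n) A') \<and>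
         represented_by (V_space p n) vs (act_b p n)
           (four_block_mat (0\<^sub>m n n) (- 1\<^sub>m n) (1\<^sub>m n) (0\<^sub>m n n))"
    using linear_matrices by blast
next
  fix e f :: real and c n p A
  assume *: "f \<noteq> 0 \<and> c = Complex e f \<and> n \<ge> 1 \<and>
      map_poly complex_of_real p = [:- c, 1:] * [:- cnj c, 1:] \<and>
      A = block_jordan n (mat_of_rows_list 2 [[e, - f], [f, e]])"
  then have "p = [:e\<^sup>2 + f\<^sup>2, - 2 * e, 1:]"
    using real_quadratic_of_conjugate_roots[of p c] by simp
  with * show "\<exists>vs A'. ordered_basis (V_space p n) vs \<and>
         A' \<in> carrier_mat (2 * n) (2 * n) \<and> inverts_mat A A' \<and> inverts_mat A' A \<and>
         represented_by (V_space p n) vs (act_a p n)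
           (four_block_mat A (0\<^sub>m (2 * n) (2 * n)) (0\<^sub>m (2 * n) (2 * n)) A') \<and>
         represented_by (V_space p n) vs (act_b p n)
           (four_block_mat (0\<^sub>m (2 * n) (2 * n)) (- 1\<^sub>m (2 * n))
                           (1\<^sub>m (2 * n)) (0\<^sub>m (2 * n) (2 * n)))"
    using quadratic_matrices by blast
qed

end
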